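(* Let $W$ be the weight system of $\mathfrak{sl}_3$ with invariant form $\langle x,y\rangle=\mathrm{tr}(xy)$, with values in $ZU(\mathfrak{sl}_3)$, and let $c_2$ be the quadratic Casimir element. For $n\ge0$ let $J_{0,n}$ be the chord diagram described below, whose intersection graph is the complete bipartite graph $K_{2,n}$. Then $$\sum_{n\ge0}W(J_{0,n})\frac{x^n}{n!}=\frac{c_2}{40}\Big((27c_2-72)e^{(c_2-8)x}+(8c_2+72)e^{(c_2-3)x}+5c_2e^{c_2x}\Big),$$ that is, for every $n\ge0$, $$W(J_{0,n})=\frac{c_2}{40}\Big((27c_2-72)(c_2-8)^n+(8c_2+72)(c_2-3)^n+5c_2^{\,n+1}\Big).$$
   Context: Chord diagrams are oriented circles with $n$ disjoint pairs of points (chords), up to orientation-preserving diffeomorphism; the intersection graph has the chords as vertices, two chords adjacent iff their endpoints alternate along the circle. For a Lie algebra $\mathfrak g$ with nondegenerate invariant form, basis $e_1,\dots,e_m$ and dual basis $e_1^*,\dots,e_m^*$, the weight system of a chord diagram is obtained by choosing a base point, labelling the first endpoint of each chord $a$ by $e_{i_a}$ and the second by $e_{i_a}^*$, multiplying the labels in the order along the circle in $U(\mathfrak g)$ and summing over all $i_a\in\{1,\dots,m\}$; the result lies in $ZU(\mathfrak g)$. Here $\mathfrak g=\mathfrak{sl}_3$ with $\langle x,y\rangle=\mathrm{tr}(xy)$ and $c_2=\sum_ie_ie_i^*$. $J_{0,n}$: counterclockwise along the circle take points $p_1,a_1,\dots,a_n,p_2,p_3,b_n,\dots,b_1,p_4$,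 with chords $p_1p_2$, $p_3p_4$ and $a_kb_k$ ($1\le k\le n$). *)

theory Defs
  imports Complex_Main
begin

type_synonym mat3 = "nat \<Rightarrow> nat \<Rightarrow> complex"

definition mmul :: "mat3 \<Rightarrow> mat3 \<Rightarrow> mat3" where
  "mmul A B = (\<lambda>i j. \<Sum>k<3. A i k * B k j)"

definition mtr :: "mat3 \<Rightarrow> complex" where
  "mtr A = (\<Sum>i<3. A i i)"

definition mE :: "nat \<Rightarrow> nat \<Rightarrow> mat3" where
  "mE p q = (\<lambda>i j. if i = p \<and> j = q then 1 else 0)"

definition mlin :: "complex \<Rightarrow> mat3 \<Rightarrow> complex \<Rightarrow> mat3 \<Rightarrow> mat3" where
  "mlin a A b B = (\<lambda>i j. a * A i j + b * B i j)"

definition mbr :: "mat3 \<Rightarrow> mat3 \<Rightarrow> mat3" where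
  "mbr A B = mlin 1 (mmul A B) (-1) (mmul B A)"

definition sl3_basis :: "nat \<Rightarrow> mat3" where
  "sl3_basis k =
     (if k = 0 then mE 0 1 else if k = 1 then mE 0 2 else if k = 2 then mE 1 0
      else if k = 3 then mE 1 2 else if k = 4 then mE 2 0 else if k = 5 then mE 2 1
      else if k = 6 then mlin 1 (mE 0 0) (-1) (mE 1 1)
      else mlin 1 (mE 1 1) (-1) (mE 2 2))"

text \<open>The dual basis e_0^*..e_7^* with respect to tr(xy): tr(e_i e_j^*) = delta_ij.\<close>
definition sl3_dual :: "nat \<Rightarrow> mat3" where
  "sl3_dual k =
     (if k = 0 then mE 1 0 else if k = 1 then mE 2 0 else if k = 2 then mE 0 1
      else if k = 3 then mE 2 1 else if k = 4 then mE 0 2 else if k = 5 then mE 1 2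
      else if k = 6 then mlin (2/3) (sl3_basis 6) (1/3) (sl3_basis 7)
      else mlin (1/3) (sl3_basis 6) (2/3) (sl3_basis 7))"

section \<open>Tensor algebra T(sl_3): noncommutative polynomials in generators X_0..X_7\<close>

text \<open>An element is a coefficient function on words (lists of generator indices).\<close>
type_synonym talg = "nat list \<Rightarrow> complex"

definition tone :: talg where "tone = (\<lambda>w. if w = [] then 1 else 0)"
definition tX :: "nat \<Rightarrow> talg" where "tX i = (\<lambda>w. if w = [i] then 1 else 0)"
definition tadd :: "talg \<Rightarrow> talg \<Rightarrow> talg" where "tadd p q = (\<lambda>w. p w + q w)"
definition tsub :: "talg \<Rightarrow> talg \<Rightarrow> talg" where "tsub p q = (\<lambda>w. p w - q w)"
definition tscale :: "complex \<Rightarrow> talg \<Rightarrow> talg" where "tscale c p = (\<lambda>w. c * p w)"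
definition tconst :: "complex \<Rightarrow> talg" where "tconst c = tscale c tone"
definition tmul :: "talg \<Rightarrow> talg \<Rightarrow> talg" where
  "tmul p q = (\<lambda>w. \<Sum>k\<le>length w. p (take k w) * q (drop k w))"
definition tpow :: "talg \<Rightarrow> nat \<Rightarrow> talg" where
  "tpow p n = ((tmul p) ^^ n) tone"

text \<open>Embedding of sl_3 into T(sl_3): M = sum_k tr(M e_k^*) e_k.\<close>
definition iota :: "mat3 \<Rightarrow> talg" where
  "iota M = (\<lambda>w. case w of [k] \<Rightarrow> (if k < 8 then mtr (mmul M (sl3_dual k)) else 0) | _ \<Rightarrow> 0)"

text \<open>The two-sided ideal of T(sl_3) defining U(sl_3) = T / (xy - yx - [x,y]).\<close>
inductive_set sl3_ideal :: "talg set" where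
  rel: "i < 8 \<Longrightarrow> j < 8 \<Longrightarrow>
        tsub (tsub (tmul (tX i) (tX j)) (tmul (tX j) (tX i)))
             (iota (mbr (sl3_basis i) (sl3_basis j))) \<in> sl3_ideal"
| zero: "(\<lambda>_. 0) \<in> sl3_ideal"
| add: "p \<in> sl3_ideal \<Longrightarrow> q \<in> sl3_ideal \<Longrightarrow> tadd p q \<in> sl3_ideal"
| scale: "p \<in> sl3_ideal \<Longrightarrow> tscale c p \<in> sl3_ideal"
| lmul: "p \<in> sl3_ideal \<Longrightarrow> k < 8 \<Longrightarrow> tmul (tX k) p \<in> sl3_ideal"
| rmul: "p \<in> sl3_ideal \<Longrightarrow> k < 8 \<Longrightarrow> tmul p (tX k) \<in> sl3_ideal"

definition U_eq :: "talg \<Rightarrow> talg \<Rightarrow> bool" where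
  "U_eq p q \<longleftrightarrow> tsub p q \<in> sl3_ideal"

text \<open>A chord diagram with a base point is a word of chord labels, each label occurring
  exactly twice, read counterclockwise from the base point.  The first endpoint of chord a
  gets e_{i_a}, the second e_{i_a}^*, and we sum over all i_a in {0..7}.\<close>
definition label_assignments :: "nat list \<Rightarrow> (nat \<Rightarrow> nat) set" where
  "label_assignments w = {f. (\<forall>a. f a < 8) \<and> (\<forall>a. a \<notin> set w \<longrightarrow> f a = 0)}"

definition sl3_weight :: "nat list \<Rightarrow> talg" where
  "sl3_weight w = (\<lambda>u. \<Sum>f\<in>label_assignments w.
      foldr tmul (map (\<lambda>k. if w ! k \<in> set (take k w) then iota (sl3_dual (f (w ! k)))
                          else tX (f (w ! k))) [0..<length w]) tone u)"

definition casimir2 :: talg where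
  "casimir2 = (\<lambda>u. \<Sum>i<8. tmul (tX i) (iota (sl3_dual i)) u)"

text \<open>J_{0,n}: chord 0 = p1p2, chord 1 = p3p4, chord k+1 = a_k b_k; base point before p1.
  Word: p1, a_1..a_n, p2, p3, b_n..b_1, p4.\<close>
definition J0 :: "nat \<Rightarrow> nat list" where
  "J0 n = [0] @ [2..<n+2] @ [0, 1] @ rev [2..<n+2] @ [1]"

definition J0_rhs :: "nat \<Rightarrow> talg" where
  "J0_rhs n = tscale (1/40) (tmul casimir2
     (tadd (tadd (tmul (tsub (tscale 27 casimir2) (tconst 72)) (tpow (tsub casimir2 (tconst 8)) n))
                 (tmul (tadd (tscale 8 casimir2) (tconst 72)) (tpow (tsub casimir2 (tconst 3)) n)))
           (tscale 5 (tpow casimir2 (n + 1)))))"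

end

theory Submission
  imports Defs
begin

text \<open>
  Write \<open>E p q\<close> for the traceless matrix unit in \<open>U(sl_3)\<close>, so that the Casimir tensor is
  \<open>\<Sum> E p q \<otimes> E q p\<close>.  A chord enclosing \<open>x\<close> contributes \<open>Phi x = \<Sum> E p q * x * E q p\<close>, which equals
  \<open>c\<^sub>2 * x\<close> minus half of the adjoint Casimir applied to \<open>x\<close>, and
  \<open>W(J_{0,n}) = \<Sum> E b a * Phi^n (E a b * E c d) * E d c\<close>.  Products of two elements of \<open>sl_3\<close> lie in
  the image of the representations of dimension 1, 8 and 27 (the two 10-dimensional constituents of
  \<open>sl_3 \<otimes> sl_3\<close> are antisymmetric and are killed), on which \<open>Phi\<close> acts as \<open>c\<^sub>2\<close>, \<open>c\<^sub>2 - 3\<close> and \<open>c\<^sub>2 - 8\<close>.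
  The three coefficients then follow from \<open>W(J_{0,0}) = c\<^sub>2\<^sup>2\<close>, \<open>W(J_{0,1}) = c\<^sub>2 (c\<^sub>2 - 3)\<^sup>2\<close> and the
  explicit one-dimensional component.
\<close>

section \<open>Traceless matrices with the commutation relations of matrix units\<close>

text \<open>Numeral coefficients become repeated sums, so that identities in a noncommutative ring
  reduce to additive cancellation of monomials.\<close>

lemma numeral_mult_expand:
  fixes x :: "'a::ring_1"
  shows "2 * x = x + x" "3 * x = x + x + x" "4 * x = x + x + x + x" "6 * x = x + x + x + x + x + x"
    "7 * x = x + x + x + x + x + x + x" "8 * x = x + x + x + x + x + x + x + x"
proof -
  have "(2::'a) = 1 + 1" "(3::'a) = 1 + 1 + 1" "(4::'a) = 1 + 1 + 1 + 1"
    "(6::'a) = 1 + 1 + 1 + 1 + 1 + 1" "(7::'a) = 1 + 1 + 1 + 1 + 1 + 1 + 1"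
    "(8::'a) = 1 + 1 + 1 + 1 + 1 + 1 + 1 + 1"
    by simp_all
  then show "2 * x = x + x" "3 * x = x + x + x" "4 * x = x + x + x + x" "6 * x = x + x + x + x + x + x"
    "7 * x = x + x + x + x + x + x + x" "8 * x = x + x + x + x + x + x + x + x"
    by (simp_all only: distrib_right mult_1_left)
qed

text \<open>Nine generators with one linear relation instead of a basis of eight: index formulas
  then keep the symmetry of matrix units.\<close>

locale sl3_matrix =
  fixes E :: "nat \<Rightarrow> nat \<Rightarrow> 'a::real_algebra_1"
  assumes commutator: "\<lbrakk>a < 3; b < 3; c < 3; d < 3\<rbrakk> \<Longrightarrow>
      E a b * E c d = E c d * E a b + (if b = c then E a d else 0) - (if a = d then E c b else 0)"
    and trace_zero: "(\<Sum>p<3. E p p) = 0"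
begin

section \<open>The Casimir element and the chord operator \<open>Phi\<close>\<close>

definition M :: "nat \<Rightarrow> nat \<Rightarrow> 'a" where
  "M a b = (\<Sum>p<3. E a p * E p b)"

definition cas :: 'a where
  "cas = (\<Sum>p<3. M p p)"

definition Phi :: "'a \<Rightarrow> 'a" where
  "Phi x = (\<Sum>p<3. \<Sum>q<3. E p q * x * E q p)"

lemma Phi_add: "Phi (x + y) = Phi x + Phi y"
  by (simp add: Phi_def algebra_simps sum.distrib)

lemma Phi_scaleR: "Phi (r *\<^sub>R x) = r *\<^sub>R Phi x"
  by (simp add: Phi_def scaleR_sum_right)

lemma linear_Phi: "linear Phi"
  by (rule linearI) (simp_all add: Phi_add Phi_scaleR)

lemma linear_Phi_funpow: "linear (Phi ^^ n)"
proof (induction n)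
  case 0 show ?case by (simp add: linear_id[unfolded id_def] id_def)
next
  case (Suc n) show ?case using linear_compose[OF Suc linear_Phi] by (simp add: o_def)
qed

text \<open>The square \<open>M\<close> of the matrix \<open>E\<close> transforms under commutators
  like \<open>E\<close> itself: by the Leibniz rule, the two terms that hit the summed index
  \<open>p\<close> cancel.\<close>

lemma E_mult_M:
  assumes "a < 3" "b < 3" "c < 3" "d < 3"
  shows "E a b * M c d = M c d * E a b + (if b = c then M a d else 0) - (if a = d then M c b else 0)"
proof -
  have "E a b * (E c p * E p d) = E c p * E p d * E a b
      + (if p = b then E c p * E a d else 0) - (if a = d then E c p * E p b else 0)
      + (if b = c then E a p * E p d else 0) - (if p = a then E c b * E p d else 0)" if p: "p < 3" for p
  proof -
    have "E a b * (E c p * E p d) = (E a b * E c p) * E p d" by (simp add: mult.assoc)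
    also have "\<dots> = E c p * (E a b * E p d) + (if b = c then E a p * E p d else 0)
        - (if p = a then E c b * E p d else 0)"
      by (subst commutator) (use assms p in \<open>auto simp: algebra_simps\<close>)
    also have "E c p * (E a b * E p d) = E c p * E p d * E a b
      + (if p = b then E c p * E a d else 0) - (if a = d then E c p * E p b else 0)"
      by (subst commutator) (use assms p in \<open>auto simp: algebra_simps\<close>)
    finally show ?thesis .
  qed
  then have "E a b * M c d = (\<Sum>p<3. E c p * E p d * E a b
      + (if p = b then E c p * E a d else 0) - (if a = d then E c p * E p b else 0)
      + (if b = c then E a p * E p d else 0) - (if p = a then E c b * E p d else 0))"
    by (simp add: M_def sum_distrib_left)
  also have "\<dots> = M c d * E a b + (if b = c then M a d else 0) - (if a = d then M c b else 0)"
    using assms by (simp add: M_def sum.distrib sum_subtractf sum_distrib_right)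
  finally show ?thesis .
qed

lemma cas_commute_E:
  assumes "a < 3" "b < 3" shows "cas * E a b = E a b * cas"
proof -
  have "E a b * M p p = M p p * E a b + (if p = b then M a b else 0) - (if p = a then M a b else 0)"
    if "p < 3" for p using E_mult_M[OF assms that that] by auto
  then have "E a b * cas = (\<Sum>p<3. M p p * E a b + (if p = b then M a b else 0) - (if p = a then M a b else 0))"
    by (simp add: cas_def sum_distrib_left)
  then show ?thesis
    using assms by (simp add: cas_def sum.distrib sum_subtractf sum_distrib_right)
qed

text \<open>Only commutation with the generators \<open>E a b\<close> is required, not with the whole ring.\<close>

definition central :: "'a \<Rightarrow> bool" where
  "central z \<longleftrightarrow> (\<forall>a<3. \<forall>b<3. z * E a b = E a b * z)"

lemma central_power: "central z \<Longrightarrow> central (z ^ n)"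
  by (simp add: central_def power_commuting_commutes)

lemma central_cas: "central cas"
  by (simp add: central_def cas_commute_E)

lemma central_cas_diff: "central (cas - numeral k)"
proof -
  have "numeral k * x = x * numeral k" for x :: 'a
    by (metis mult_of_nat_commute of_nat_numeral)
  then show ?thesis by (simp add: central_def cas_commute_E algebra_simps)
qed

lemma Phi_central: assumes "central z" shows "Phi (z * x) = z * Phi x"
proof -
  have "E p q * (z * x) * E q p = z * (E p q * x * E q p)" if "p < 3" "q < 3" for p q
    using assms that by (metis central_def mult.assoc)
  then show ?thesis by (simp add: Phi_def sum_distrib_left)
qed

lemma cas_eq: "cas = (\<Sum>p<3. \<Sum>q<3. E p q * E q p)"
  by (simp add: cas_def M_def)

lemma Phi_one: "Phi 1 = cas"
  by (simp add: Phi_def cas_eq)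

text \<open>Commuting the factors leaves one \<open>E c b\<close> for each of the three values of
  \<open>p\<close>; the trace term vanishes.\<close>

lemma sum_opposite:
  assumes "b < 3" "c < 3"
  shows "(\<Sum>p<3. E p b * E c p) = M c b - 3 * E c b"
proof -
  have "E p b * E c p = E c p * E p b + (if b = c then E p p else 0) - E c b" if "p < 3" for p
    using commutator[of p b c p] assms that by simp
  then have "(\<Sum>p<3. E p b * E c p) = (\<Sum>p<3. E c p * E p b + (if b = c then E p p else 0) - E c b)"
    by simp
  also have "\<dots> = M c b - 3 * E c b"
    using trace_zero by (cases "b = c") (simp_all add: M_def sum.distrib sum_subtractf)
  finally show ?thesis .
qed

text \<open>Moving the right endpoint of the chord past \<open>E c d\<close> costs one commutator,
  whose two terms force \<open>q = d\<close> and \<open>p = c\<close>.\<close>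

lemma Phi_mult_E:
  assumes cd: "c < 3" "d < 3"
  shows "Phi (x * E c d) = Phi x * E c d + (\<Sum>p<3. E p d * x * E c p) - (\<Sum>q<3. E c q * x * E q d)"
proof -
  have "E p q * (x * E c d) * E q p = E p q * x * E q p * E c d
      + (if q = d then E p q * x * E c p else 0) - (if p = c then E p q * x * E q d else 0)"
    if "p < 3" "q < 3" for p q
  proof -
    have "E p q * (x * E c d) * E q p = E p q * x * (E c d * E q p)" by (simp add: mult.assoc)
    also have "\<dots> = E p q * x * E q p * E c d
      + (if q = d then E p q * x * E c p else 0) - (if p = c then E p q * x * E q d else 0)"
      by (subst commutator) (use cd that in \<open>auto simp: algebra_simps\<close>)
    finally show ?thesis .
  qed
  then have "Phi (x * E c d) = (\<Sum>p<3. \<Sum>q<3. E p q * x * E q p * E c d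
      + (if q = d then E p q * x * E c p else 0) - (if p = c then E p q * x * E q d else 0))"
    by (simp add: Phi_def)
  also have "\<dots> = (\<Sum>p<3. \<Sum>q<3. E p q * x * E q p * E c d)
      + (\<Sum>p<3. \<Sum>q<3. if q = d then E p q * x * E c p else 0)
      - (\<Sum>q<3. \<Sum>p<3. if p = c then E p q * x * E q d else 0)"
    by (subst (3) sum.swap) (simp add: sum.distrib sum_subtractf)
  also have "\<dots> = Phi x * E c d + (\<Sum>p<3. E p d * x * E c p) - (\<Sum>q<3. E c q * x * E q d)"
    using cd by (simp add: Phi_def sum_distrib_right)
  finally show ?thesis .
qed

text \<open>For \<open>x = 1\<close> the two correction sums of \<open>Phi_mult_E\<close> are the
  two orders of contraction, which differ by \<open>3 * E a b\<close>. The 3 is half the adjoint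
  Casimir value.\<close>

lemma Phi_E:
  assumes "a < 3" "b < 3"
  shows "Phi (E a b) = (cas - 3) * E a b"
  using Phi_mult_E[OF assms, of 1] sum_opposite[of b a] assms
  by (simp add: Phi_one M_def algebra_simps)

text \<open>The 6 collects one 3 from \<open>Phi_E\<close> and one from \<open>sum_opposite\<close>.
  The products with exchanged second indices keep this from being an eigenvector equation.\<close>

lemma Phi_E_mult_E:
  assumes "a < 3" "b < 3" "c < 3" "d < 3"
  shows "Phi (E a b * E c d) = (cas - 6) * (E a b * E c d) - E c b * E a d - E a d * E c b
    + (if b = c then M a d else 0) + (if a = d then M c b - 3 * E c b else 0)"
proof -
  have "E p d * E a b * E c p = E a b * (E p d * E c p) + (if a = d then E p b * E c p else 0)
      - (if p = b then E a d * E c p else 0)" if "p < 3" for p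
    by (subst commutator) (use assms that in \<open>auto simp: algebra_simps\<close>)
  then have 1: "(\<Sum>p<3. E p d * E a b * E c p)
      = E a b * (M c d - 3 * E c d) + (if a = d then M c b - 3 * E c b else 0) - E a d * E c b"
    using assms by (simp add: sum.distrib sum_subtractf flip: sum_distrib_left sum_opposite)
  have "E c q * E a b * E q d = E a b * (E c q * E q d) + (if q = a then E c b * E q d else 0)
      - (if b = c then E a q * E q d else 0)" if "q < 3" for q
    by (subst commutator) (use assms that in \<open>auto simp: algebra_simps\<close>)
  then have 2: "(\<Sum>q<3. E c q * E a b * E q d)
      = E a b * M c d + E c b * E a d - (if b = c then M a d else 0)"
    using assms by (simp add: M_def sum.distrib sum_subtractf flip: sum_distrib_left)
  have 3: "E a b * (3 * E c d) = 3 * (E a b * E c d)"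
    by (metis mult.assoc mult_of_nat_commute of_nat_numeral)
  show ?thesis
    using assms by (simp add: Phi_mult_E Phi_E 1 2)
      (simp add: algebra_simps 3 numeral_mult_expand)
qed

lemma Phi_sum: "Phi (sum f A) = (\<Sum>i\<in>A. Phi (f i))"
  by (rule linear_sum[OF linear_Phi])

lemma Phi_diff: "Phi (x - y) = Phi x - Phi y"
  by (rule linear_diff[OF linear_Phi])

text \<open>Contracting \<open>Phi_E_mult_E\<close> over \<open>b = c\<close> turns the exchanged
  products into multiples of the trace of \<open>E\<close>, which vanish; \<open>M a d\<close>,
  counted three times, moves \<open>cas - 6\<close> to \<open>cas - 3\<close>.\<close>

lemma Phi_M:
  assumes "a < 3" "d < 3"
  shows "Phi (M a d) = (cas - 3) * M a d + (if a = d then cas else 0)"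
proof -
  have "Phi (E a p * E p d) = (cas - 6) * (E a p * E p d) - E p p * E a d - E a d * E p p
    + M a d + (if a = d then M p p - 3 * E p p else 0)" if "p < 3" for p
    using Phi_E_mult_E[of a p p d] assms that by simp
  then have "Phi (M a d) = (\<Sum>p<3. (cas - 6) * (E a p * E p d) - E p p * E a d - E a d * E p p
    + M a d + (if a = d then M p p - 3 * E p p else 0))"
    by (simp add: M_def Phi_sum)
  also have "\<dots> = (cas - 6) * M a d + 3 * M a d + (if a = d then cas else 0)"
    using trace_zero
    by (simp add: sum.distrib sum_subtractf cas_def M_def[of a d] flip: sum_distrib_left sum_distrib_right)
  finally show ?thesis by (simp add: algebra_simps numeral_mult_expand)
qed

section \<open>Eigenvectors of \<open>Phi\<close> among quadratic elements\<close>

definition \<delta> :: "nat \<Rightarrow> nat \<Rightarrow> 'a" where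
  "\<delta> a b = (if a = b then 1 else 0)"

text \<open>This is the step that uses the dimension three: \<open>\<Lambda>\<^sup>2 V \<otimes> \<Lambda>\<^sup>2 V*\<close> is isomorphic to
  \<open>V* \<otimes> V\<close>, so the quadratic minors of \<open>E\<close> are linear in
  \<open>E\<^sup>2\<close>, \<open>E\<close> and the Casimir element.
  The coefficients are forced by the traces over \<open>a = b\<close> and \<open>c = d\<close>.\<close>

lemma minor_identity:
  assumes "a < 3" "b < 3" "c < 3" "d < 3"
  shows "2 * (E a b * E c d - E c b * E a d) =
      2 * (\<delta> c b * M a d + \<delta> a d * M c b - \<delta> a b * M c d - \<delta> c d * M a b)
      + (\<delta> a b * \<delta> c d - \<delta> a d * \<delta> c b) * cas
      + 2 * \<delta> a b * E c d + 4 * \<delta> c d * E a b - 2 * \<delta> c b * E a d - 4 * \<delta> a d * E c b"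
proof -
  \<comment> \<open>Eliminating \<open>E 2 2\<close> removes the one linear relation, so that
    ordered monomials in the other eight generators can serve as a PBW normal form.\<close>
  have E22: "E 2 2 = - E 0 0 - E (Suc 0) (Suc 0)"
    using trace_zero by (simp add: numeral_3_eq_3 numeral_2_eq_2 add_eq_0_iff algebra_simps)
  \<comment> \<open>Rewriting with this rule puts quadratic monomials into lexicographic normal form.\<close>
  have order: "E a b * E c d = E c d * E a b + (if b = c then E a d else 0) - (if a = d then E c b else 0)"
    if "3 * a + b > 3 * c + d" "a < 3" "b < 3" "c < 3" "d < 3" for a b c d
    using commutator that by blast
  have lt3: "x = 0 \<or> x = Suc 0 \<or> x = 2" if "x < 3" for x :: nat using that by auto
  have three: "{..<3} = {0, Suc 0, 2::nat}" by auto
  show ?thesis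
    using lt3[OF assms(1)] lt3[OF assms(2)] lt3[OF assms(3)] lt3[OF assms(4)]
    by (elim disjE) (simp_all add: \<delta>_def, simp_all add: M_def cas_def three,
      simp_all add: E22 algebra_simps order numeral_mult_expand)
qed

lemma central_numeral: "central (numeral k)"
  unfolding central_def by (metis mult_of_nat_commute of_nat_numeral)

lemma central_delta: "central (\<delta> a b)"
  by (simp add: central_def \<delta>_def)

lemma central_mult: "central x \<Longrightarrow> central y \<Longrightarrow> central (x * y)"
  unfolding central_def by (metis mult.assoc)

lemma central_diff: "central x \<Longrightarrow> central y \<Longrightarrow> central (x - y)"
  unfolding central_def by (simp add: algebra_simps)

text \<open>\<open>Q\<close> and \<open>K\<close> are the successive defects of \<open>E a b * E c d\<close> from being an
  eigenvector of \<open>Phi\<close> for \<open>cas - 8\<close> and then for \<open>cas - 3\<close>.\<close>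

definition Q :: "nat \<Rightarrow> nat \<Rightarrow> nat \<Rightarrow> nat \<Rightarrow> 'a" where
  "Q a b c d = 2 * (\<delta> a b * M c d + \<delta> c d * M a b) - 3 * (\<delta> c b * M a d + \<delta> a d * M c b)
     - (\<delta> a b * \<delta> c d - \<delta> a d * \<delta> c b) * cas
     - 3 * (\<delta> a b * E c d + \<delta> c d * E a b) + 2 * (\<delta> c b * E a d) + 7 * (\<delta> a d * E c b)"

definition K :: "nat \<Rightarrow> nat \<Rightarrow> nat \<Rightarrow> nat \<Rightarrow> 'a" where
  "K a b c d = (3 * \<delta> a d * \<delta> c b - \<delta> a b * \<delta> c d) * cas"

text \<open>\<open>K\<close> is a central multiple of \<open>1\<close>, and \<open>Phi\<close>
  multiplies such an element by \<open>Phi 1 = cas\<close>.\<close>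

lemma Phi_K: "Phi (K a b c d) = cas * K a b c d"
proof -
  have "central (3 * \<delta> a d * \<delta> c b - \<delta> a b * \<delta> c d)"
    by (intro central_diff central_mult central_delta central_numeral)
  then have "Phi (K a b c d) = (3 * \<delta> a d * \<delta> c b - \<delta> a b * \<delta> c d) * Phi (cas * 1)"
    by (simp add: K_def Phi_central)
  \<comment> \<open>The factor \<open>1\<close> lets \<open>Phi_central\<close> pull out
    \<open>cas\<close>.\<close>
  also have "Phi (cas * 1) = cas * cas"
    by (simp only: Phi_central central_cas Phi_one)
  finally show ?thesis
    by (simp only:) (simp add: K_def \<delta>_def algebra_simps numeral_mult_expand)
qed

text \<open>The \<open>E\<close> terms are exact eigenvectors for \<open>cas - 3\<close>. The defect
  \<open>K\<close> comes from the extra \<open>cas\<close> in \<open>Phi_M\<close> and from the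
  \<open>cas\<close> term of \<open>Q\<close>, on which \<open>Phi\<close> acts by
  \<open>cas\<close>.\<close>

lemma Phi_Q:
  assumes "a < 3" "b < 3" "c < 3" "d < 3"
  shows "Phi (Q a b c d) = (cas - 3) * Q a b c d - K a b c d"
proof -
  have Phi_delta: "Phi (\<delta> i j * x) = \<delta> i j * Phi x" for i j x
    by (rule Phi_central[OF central_delta])
  have Phi_numeral: "Phi (numeral k * x) = numeral k * Phi x" for k x
    by (rule Phi_central[OF central_numeral])
  have "Phi (cas * 1) = cas * cas"
    by (simp only: Phi_central central_cas Phi_one)
  then have Phi_cas: "Phi cas = cas * cas" by simp
  show ?thesis
    unfolding Q_def K_def left_diff_distrib mult.assoc Phi_diff Phi_add Phi_delta Phi_numeral Phi_cas
      Phi_M[OF assms(3,4)] Phi_M[OF assms(1,2)] Phi_M[OF assms(1,4)] Phi_M[OF assms(3,2)]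
      Phi_E[OF assms(3,4)] Phi_E[OF assms(1,2)] Phi_E[OF assms(1,4)] Phi_E[OF assms(3,2)]
    by (cases "a = b"; cases "c = d"; cases "a = d"; cases "c = b")
      (simp_all add: \<delta>_def algebra_simps numeral_mult_expand)
qed

text \<open>Up to linear terms, \<open>Phi_E_mult_E\<close> contains
  \<open>- 2 * (E c b * E a d)\<close>; the minor identity trades it for
  \<open>- 2 * (E a b * E c d)\<close>, which lowers \<open>cas - 6\<close> to
  \<open>cas - 8\<close>.\<close>

lemma Phi_E_mult_E_eq_Q:
  assumes "a < 3" "b < 3" "c < 3" "d < 3"
  shows "Phi (E a b * E c d) = (cas - 8) * (E a b * E c d) - Q a b c d"
proof -
  have *: "E a d * E c b = E c b * E a d + \<delta> c d * E a b - \<delta> a b * E c d"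
    using commutator[of a d c b] assms by (simp add: \<delta>_def)
  show ?thesis
    using minor_identity[OF assms] unfolding Phi_E_mult_E[OF assms] * Q_def
    by (cases "a = b"; cases "c = d"; cases "a = d"; cases "c = b")
      (simp_all add: \<delta>_def algebra_simps numeral_mult_expand)
qed

section \<open>Closing the two outer chords\<close>

text \<open>\<open>E b a\<close> and \<open>E d c\<close> are the labels at \<open>p_1\<close> and
  \<open>p_4\<close>; the labels \<open>E a b\<close> and \<open>E c d\<close> at \<open>p_2\<close>
  and \<open>p_3\<close> enter through \<open>F\<close>.\<close>

definition contr :: "(nat \<Rightarrow> nat \<Rightarrow> nat \<Rightarrow> nat \<Rightarrow> 'a) \<Rightarrow> 'a" where
  "contr F = (\<Sum>a<3. \<Sum>b<3. \<Sum>c<3. \<Sum>d<3. E b a * F a b c d * E d c)"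

lemma contr_sum: "contr (\<lambda>a b c d. \<Sum>i\<in>I. F i a b c d) = (\<Sum>i\<in>I. contr (F i))"
  unfolding contr_def sum_distrib_left sum_distrib_right
  by (simp only: sum.swap[of _ I])

lemma contr_cong:
  "(\<And>a b c d. \<lbrakk>a < 3; b < 3; c < 3; d < 3\<rbrakk> \<Longrightarrow> F a b c d = G a b c d) \<Longrightarrow> contr F = contr G"
  unfolding contr_def by (intro sum.cong refl) simp

lemma contr_add: "contr (\<lambda>a b c d. F a b c d + G a b c d) = contr F + contr G"
  by (simp add: contr_def algebra_simps sum.distrib)

lemma contr_diff: "contr (\<lambda>a b c d. F a b c d - G a b c d) = contr F - contr G"
  by (simp add: contr_def algebra_simps sum_subtractf)

lemma contr_scaleR: "contr (\<lambda>a b c d. r *\<^sub>R F a b c d) = r *\<^sub>R contr F"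
  by (simp add: contr_def scaleR_sum_right)

lemma contr_central:
  assumes "central z" shows "contr (\<lambda>a b c d. z * F a b c d) = z * contr F"
proof -
  have "E b a * (z * x) * E d c = z * (E b a * x * E d c)" if "a < 3" "b < 3" for a b c d x
    using assms that by (metis central_def mult.assoc)
  then show ?thesis by (simp add: contr_def sum_distrib_left)
qed

lemma contr_factor:
  "contr (\<lambda>a b c d. G a b * H c d) = (\<Sum>a<3. \<Sum>b<3. E b a * G a b) * (\<Sum>c<3. \<Sum>d<3. H c d * E d c)"
  by (simp add: contr_def mult.assoc flip: sum_distrib_left)
    (simp add: sum_distrib_right mult.assoc)

text \<open>The diagram for \<open>n = 0\<close>: two disjoint chords, each contributing a factor
  \<open>cas\<close>.\<close>

lemma contr_E_mult_E: "contr (\<lambda>a b c d. E a b * E c d) = cas\<^sup>2"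
proof -
  have "(\<Sum>a<3. \<Sum>b<3. E b a * E a b) = cas"
    unfolding cas_eq by (rule sum.swap)
  then show ?thesis
    by (simp add: contr_factor power2_eq_square flip: cas_eq)
qed

text \<open>The chord of \<open>Phi\<close> splits the contraction into two factors, each of which is again \<open>Phi\<close>
  applied to a matrix entry.\<close>

lemma contr_Phi: "contr (\<lambda>a b c d. Phi (E a b * E c d)) = cas * (cas - 3)\<^sup>2"
proof -
  have L: "(\<Sum>a<3. \<Sum>b<3. E b a * (E p q * E a b)) = (cas - 3) * E p q" if "p < 3" "q < 3" for p q
    unfolding Phi_E[OF that, symmetric] Phi_def mult.assoc by (rule sum.swap)
  have R: "(\<Sum>c<3. \<Sum>d<3. E c d * E q p * E d c) = (cas - 3) * E q p" if "p < 3" "q < 3" for p q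
    unfolding Phi_E[OF that(2,1), symmetric] Phi_def ..
  have "contr (\<lambda>a b c d. Phi (E a b * E c d))
      = contr (\<lambda>a b c d. \<Sum>p<3. \<Sum>q<3. (E p q * E a b) * (E c d * E q p))"
    by (simp add: Phi_def mult.assoc)
  also have "\<dots> = (\<Sum>p<3. \<Sum>q<3. contr (\<lambda>a b c d. (E p q * E a b) * (E c d * E q p)))"
    by (simp only: contr_sum)
  also have "\<dots> = (\<Sum>p<3. \<Sum>q<3. ((cas - 3) * E p q) * ((cas - 3) * E q p))"
    by (simp add: contr_factor L R)
  also have "\<dots> = (\<Sum>p<3. \<Sum>q<3. (cas - 3)\<^sup>2 * (E p q * E q p))"
  proof (intro sum.cong refl, goal_cases)
    case (1 p q)
    then have *: "E p q * (cas - 3) = (cas - 3) * E p q"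
      using central_cas_diff by (auto simp: central_def)
    have "(cas - 3) * E p q * ((cas - 3) * E q p) = (cas - 3) * (E p q * (cas - 3)) * E q p"
      by (simp only: mult.assoc)
    also have "\<dots> = (cas - 3)\<^sup>2 * (E p q * E q p)"
      by (simp only: * power2_eq_square mult.assoc)
    finally show ?case .
  qed
  also have "\<dots> = (cas - 3)\<^sup>2 * cas"
    by (simp add: cas_eq sum_distrib_left)
  also have "\<dots> = cas * (cas - 3)\<^sup>2"
  proof (rule power_commuting_commutes)
    have "3 * cas = cas * 3" by (metis mult_of_nat_commute of_nat_numeral)
    then show "(cas - 3) * cas = cas * (cas - 3)"
      by (simp only: left_diff_distrib right_diff_distrib)
  qed
  finally show ?thesis .
qed

text \<open>The pattern \<open>a = d\<close>, \<open>c = b\<close> closes up to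
  \<open>3 * Phi cas\<close>; the pattern \<open>a = b\<close>, \<open>c = d\<close> gives the trace
  of \<open>E\<close> as a factor and vanishes.\<close>

lemma contr_K: "contr K = 3 * cas\<^sup>2"
proof -
  have "E b a * K a b c d * E d c = (if c = b then if d = a then 3 * (E b a * cas * E a b) else 0 else 0)
      - (if b = a then if d = c then E a a * cas * E c c else 0 else 0)" for a b c d
  proof -
    have 1: "K a b c d = (if c = b then if d = a then 3 * cas else 0 else 0)
      - (if b = a then if d = c then cas else 0 else 0)"
      by (auto simp: K_def \<delta>_def left_diff_distrib)
    have 2: "E b a * (3 * cas) * E a b = 3 * (E b a * cas * E a b)"
      by (simp add: numeral_mult_expand distrib_left distrib_right)
    show ?thesis
      unfolding 1 left_diff_distrib right_diff_distrib using 2 by auto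
  qed
  moreover have "(\<Sum>d<3. if C then f d else 0) = (if C then \<Sum>d<3. f d else 0)" for C and f :: "nat \<Rightarrow> 'a"
    by simp
  ultimately have "contr K = (\<Sum>a<3. \<Sum>b<3. 3 * (E b a * cas * E a b)) - (\<Sum>a<3. \<Sum>b<3. if b = a then \<Sum>c<3. E a a * cas * E c c else 0)"
    by (simp add: contr_def sum_subtractf)
  also have "(\<Sum>a<3. \<Sum>b<3. if b = a then \<Sum>c<3. E a a * cas * E c c else 0) = 0"
    using trace_zero by (simp flip: sum_distrib_left)
  also have "(\<Sum>a<3. \<Sum>b<3. 3 * (E b a * cas * E a b)) = 3 * Phi (cas * 1)"
    by (subst sum.swap) (simp add: Phi_def sum_distrib_left)
  also have "Phi (cas * 1) = cas\<^sup>2"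
    by (simp only: Phi_central central_cas Phi_one power2_eq_square)
  finally show ?thesis by simp
qed

lemma Phi_funpow_eigen:
  assumes "central z" "Phi x = z * x"
  shows "(Phi ^^ n) x = z ^ n * x"
  by (induction n) (simp_all add: assms Phi_central central_power power_Suc2 mult.assoc del: power_Suc)

text \<open>\<open>T\<close> is the one-dimensional component and \<open>S\<close> the adjoint one.
  \<open>Q + K/3\<close> is an eigenvector for \<open>cas - 3\<close>, and the coefficients solve
  \<open>5 S + 8 T = - Q\<close>, where 5 and 8 are the distances of the other two eigenvalues from
  \<open>cas - 8\<close>.\<close>

lemma funpow_Phi_E_mult_E:
  assumes "a < 3" "b < 3" "c < 3" "d < 3"
  defines "T \<equiv> (1/24) *\<^sub>R K a b c d"
    and "S \<equiv> (-1/5) *\<^sub>R Q a b c d - (1/15) *\<^sub>R K a b c d"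
  shows "(Phi ^^ n) (E a b * E c d)
    = (cas - 8) ^ n * (E a b * E c d - S - T) + (cas - 3) ^ n * S + cas ^ n * T"
proof -
  have 8: "(cas - 8) * x = cas * x - 8 *\<^sub>R x" and 3: "(cas - 3) * x = cas * x - 3 *\<^sub>R x" for x
    by (simp_all add: algebra_simps scaleR_conv_of_real)
  have T: "Phi T = cas * T"
    by (simp add: T_def Phi_scaleR Phi_K)
  have S: "Phi S = (cas - 3) * S"
    unfolding S_def Phi_diff Phi_scaleR Phi_K Phi_Q[OF assms(1-4)] 3
    by (simp add: algebra_simps)
  have P: "Phi (E a b * E c d - S - T) = (cas - 8) * (E a b * E c d - S - T)"
    unfolding Phi_diff S T Phi_E_mult_E_eq_Q[OF assms(1-4)] 3 8
    \<comment> \<open>These instances split the coefficients 8/5 of \<open>Q\<close> and 8/15 of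
      \<open>K\<close> that arise from \<open>8 *\<^sub>R S\<close>.\<close>
    using scaleR_left_distrib[of 1 "3/5" "Q a b c d"] scaleR_left_distrib[of "1/3" "1/5" "K a b c d"]
    by (simp add: S_def T_def algebra_simps)
  have "(Phi ^^ n) (E a b * E c d) = (Phi ^^ n) ((E a b * E c d - S - T) + S + T)" by simp
  also have "\<dots> = (Phi ^^ n) (E a b * E c d - S - T) + (Phi ^^ n) S + (Phi ^^ n) T"
    by (simp only: linear_add[OF linear_Phi_funpow])
  finally show ?thesis
    by (simp only: Phi_funpow_eigen[OF central_cas_diff P] Phi_funpow_eigen[OF central_cas_diff S]
        Phi_funpow_eigen[OF central_cas T])
qed

theorem contr_funpow_Phi:
  "contr (\<lambda>a b c d. (Phi ^^ n) (E a b * E c d)) = (1/40) *\<^sub>R (cas *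
     ((27 * cas - 72) * (cas - 8) ^ n + (8 * cas + 72) * (cas - 3) ^ n + 5 * cas ^ (n + 1)))"
proof -
  have num: "numeral k * x = numeral k *\<^sub>R x" for x :: 'a and k
    by (simp add: scaleR_conv_of_real)
  define T where "T = (\<lambda>a b c d. (1/24) *\<^sub>R K a b c d)"
  define S where "S = (\<lambda>a b c d. (-1/5) *\<^sub>R Q a b c d - (1/15) *\<^sub>R K a b c d)"
  \<comment> \<open>\<open>contr Q\<close> is not expanded from its definition: the known value for
    \<open>n = 1\<close> determines it.\<close>
  have "contr (\<lambda>a b c d. (cas - 8) * (E a b * E c d) - Q a b c d) = cas * (cas - 3)\<^sup>2"
    unfolding contr_Phi[symmetric] by (rule contr_cong) (simp add: Phi_E_mult_E_eq_Q)
  then have "contr Q = (cas - 8) * cas\<^sup>2 - cas * (cas - 3)\<^sup>2"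
    unfolding contr_diff contr_central[OF central_cas_diff] contr_E_mult_E
    by (simp add: algebra_simps)
  also have "\<dots> = - 2 * cas\<^sup>2 - 9 * cas"
  proof -
    have comm: "cas * (numeral k * x) = numeral k * (cas * x)" "cas * numeral k = numeral k * cas" for x k
      by (metis mult.assoc mult_of_nat_commute of_nat_numeral)+
    have nine: "9 * x = 8 * x + x" for x :: 'a
      using distrib_right[of 8 1 x] by simp
    show ?thesis
      by (simp add: power2_eq_square left_diff_distrib right_diff_distrib comm)
        (simp add: comm numeral_mult_expand nine algebra_simps)
  qed
  finally have Q: "contr Q = - 2 * cas\<^sup>2 - 9 * cas" .
  have T: "contr T = (5/40) *\<^sub>R cas\<^sup>2"
    by (simp add: T_def contr_scaleR contr_K num)
  have S: "contr S = (1/40) *\<^sub>R (8 * cas\<^sup>2 + 72 * cas)"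
    unfolding S_def contr_diff contr_scaleR contr_K Q minus_mult_left[symmetric] num
    by (simp add: scaleR_diff_right scaleR_add_right flip: scaleR_left_diff_distrib)
  have P: "contr (\<lambda>a b c d. E a b * E c d - S a b c d - T a b c d) = (1/40) *\<^sub>R (27 * cas\<^sup>2 - 72 * cas)"
    unfolding contr_diff S T contr_E_mult_E num
    using scaleR_left_diff_distrib[of 1 "1/5" "cas\<^sup>2"] scaleR_left_diff_distrib[of "4/5" "1/8" "cas\<^sup>2"]
    by (simp add: scaleR_diff_right scaleR_add_right algebra_simps)
  have "contr (\<lambda>a b c d. (Phi ^^ n) (E a b * E c d)) = contr (\<lambda>a b c d.
     (cas - 8) ^ n * (E a b * E c d - S a b c d - T a b c d) + (cas - 3) ^ n * S a b c d + cas ^ n * T a b c d)"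
    by (rule contr_cong) (simp add: funpow_Phi_E_mult_E S_def T_def)
  also have "\<dots> = (cas - 8) ^ n * (1/40) *\<^sub>R (27 * cas\<^sup>2 - 72 * cas)
      + (cas - 3) ^ n * (1/40) *\<^sub>R (8 * cas\<^sup>2 + 72 * cas) + cas ^ n * (5/40) *\<^sub>R cas\<^sup>2"
    by (simp add: contr_add contr_central central_cas central_cas_diff central_power P S T)
  also have "\<dots> = (1/40) *\<^sub>R (cas *
     ((27 * cas - 72) * (cas - 8) ^ n + (8 * cas + 72) * (cas - 3) ^ n + 5 * cas ^ (n + 1)))"
  proof -
    \<comment> \<open>The ring is noncommutative, so powers of the shifted Casimir are moved past
      polynomials in \<open>cas\<close> explicitly.\<close>
    have comm: "z * (1/40) *\<^sub>R (cas * x) = (1/40) *\<^sub>R (cas * (x * z))"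
      if "z = y ^ n" "cas * y = y * cas" "x * y = y * x" for x y z
    proof -
      have "z * cas = cas * z" "z * x = x * z"
        using that by (simp_all add: power_commuting_commutes)
      then show ?thesis by (simp flip: mult.assoc) (simp add: mult.assoc)
    qed
    have c: "cas * numeral k = numeral k * cas" "cas * (numeral k * x) = numeral k * (cas * x)" for k x
      by (metis mult.assoc mult_of_nat_commute of_nat_numeral)+
    have 1: "27 * cas\<^sup>2 - 72 * cas = cas * (27 * cas - 72)"
      and 2: "8 * cas\<^sup>2 + 72 * cas = cas * (8 * cas + 72)"
      by (simp_all add: c power2_eq_square right_diff_distrib distrib_left)
    have 3: "(5/40) *\<^sub>R cas\<^sup>2 = (1/40) *\<^sub>R (cas * (5 * cas))"
      by (simp add: power2_eq_square num)
    have "(cas - 8) ^ n * (1/40) *\<^sub>R (cas * (27 * cas - 72)) = (1/40) *\<^sub>R (cas * ((27 * cas - 72) * (cas - 8) ^ n))"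
      by (rule comm[OF refl])
        (simp_all add: c left_diff_distrib right_diff_distrib distrib_left distrib_right mult.assoc)
    moreover have "(cas - 3) ^ n * (1/40) *\<^sub>R (cas * (8 * cas + 72)) = (1/40) *\<^sub>R (cas * ((8 * cas + 72) * (cas - 3) ^ n))"
      by (rule comm[OF refl])
        (simp_all add: c left_diff_distrib right_diff_distrib distrib_left distrib_right mult.assoc)
    moreover have "cas ^ n * (1/40) *\<^sub>R (cas * (5 * cas)) = (1/40) *\<^sub>R (cas * (5 * cas ^ (n + 1)))"
      by (subst comm[OF refl]) (simp_all add: c mult.assoc)
    ultimately show ?thesis
      unfolding 1 2 3 by (simp only: distrib_left scaleR_add_right)
  qed
  finally show ?thesis .
qed

end

section \<open>The universal enveloping algebra as a quotient type\<close>

lemma tmul_Nil: "tmul p q [] = p [] * q []"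
  by (simp add: tmul_def)

text \<open>Splitting off the empty prefix gives a recursion through the left derivative of
  \<open>p\<close> by the letter \<open>x\<close>; the unit and associativity laws rest on
  it.\<close>

lemma tmul_Cons: "tmul p q (x # w) = p [] * q (x # w) + tmul (\<lambda>w. p (x # w)) q w"
  by (simp add: tmul_def sum.atMost_Suc_shift del: sum.atMost_Suc)

lemma tmul_tadd_left: "tmul (tadd p q) r = tadd (tmul p r) (tmul q r)"
  by (rule ext) (simp add: tmul_def tadd_def algebra_simps sum.distrib)

lemma tmul_tadd_right: "tmul r (tadd p q) = tadd (tmul r p) (tmul r q)"
  by (rule ext) (simp add: tmul_def tadd_def algebra_simps sum.distrib)

lemma tmul_tsub_left: "tmul (tsub p q) r = tsub (tmul p r) (tmul q r)"
  by (rule ext) (simp add: tmul_def tsub_def algebra_simps sum_subtractf)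

lemma tmul_tsub_right: "tmul r (tsub p q) = tsub (tmul r p) (tmul r q)"
  by (rule ext) (simp add: tmul_def tsub_def algebra_simps sum_subtractf)

lemma tmul_tscale_left: "tmul (tscale c p) q = tscale c (tmul p q)"
  by (rule ext) (simp add: tmul_def tscale_def sum_distrib_left mult.assoc)

lemma tmul_tscale_right: "tmul p (tscale c q) = tscale c (tmul p q)"
  by (rule ext) (simp add: tmul_def tscale_def sum_distrib_left algebra_simps)

lemma tmul_zero_left: "tmul (\<lambda>_. 0) p = (\<lambda>_. 0)"
  by (rule ext) (simp add: tmul_def)

lemma tmul_zero_right: "tmul p (\<lambda>_. 0) = (\<lambda>_. 0)"
  by (rule ext) (simp add: tmul_def)

lemma tmul_tone_left: "tmul tone p = p"
proof
  fix w show "tmul tone p w = p w"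
    by (cases w) (simp_all add: tmul_Nil tmul_Cons tone_def tmul_zero_left)
qed

lemma tmul_tone_right: "tmul p tone = p"
proof
  fix w show "tmul p tone w = p w"
    by (induction w arbitrary: p) (simp_all add: tmul_Nil tmul_Cons, simp_all add: tone_def)
qed

lemma tmul_assoc: "tmul (tmul p q) r = tmul p (tmul q r)"
proof
  fix w show "tmul (tmul p q) r w = tmul p (tmul q r) w"
  proof (induction w arbitrary: p q)
    case Nil show ?case by (simp add: tmul_Nil)
  next
    case (Cons x w)
    \<comment> \<open>The product rule for the left derivative by \<open>x\<close>.\<close>
    have "(\<lambda>w. tmul p q (x # w)) = tadd (tscale (p []) (\<lambda>w. q (x # w))) (tmul (\<lambda>w. p (x # w)) q)"
      by (simp add: tmul_Cons tadd_def tscale_def)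
    then show ?case
      by (simp add: tmul_Cons tmul_Nil tmul_tadd_left tmul_tscale_left Cons.IH)
        (simp add: tadd_def tscale_def algebra_simps Cons.IH)
  qed
qed

text \<open>A \<open>talg\<close> may have infinite support and use letters beyond \<open>7\<close>; the ideal
  \<open>sl3_ideal\<close> is closed only under multiplication by genuine polynomials in \<open>X_0, ..., X_7\<close>.\<close>

inductive_set nc_poly :: "talg set" where
  zero: "(\<lambda>_. 0) \<in> nc_poly"
| one: "tone \<in> nc_poly"
| add: "p \<in> nc_poly \<Longrightarrow> q \<in> nc_poly \<Longrightarrow> tadd p q \<in> nc_poly"
| scale: "p \<in> nc_poly \<Longrightarrow> tscale c p \<in> nc_poly"
| lmul: "p \<in> nc_poly \<Longrightarrow> k < 8 \<Longrightarrow> tmul (tX k) p \<in> nc_poly"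

lemma nc_poly_tX: "k < 8 \<Longrightarrow> tX k \<in> nc_poly"
  using nc_poly.lmul[OF nc_poly.one] by (simp add: tmul_tone_right)

lemma nc_poly_tmul: "p \<in> nc_poly \<Longrightarrow> q \<in> nc_poly \<Longrightarrow> tmul p q \<in> nc_poly"
  by (induction rule: nc_poly.induct)
    (auto simp: tmul_zero_left tmul_tone_left tmul_tadd_left tmul_tscale_left tmul_assoc intro: nc_poly.intros)

lemma tsub_eq: "tsub p q = tadd p (tscale (-1) q)"
  by (simp add: tsub_def tadd_def tscale_def)

lemma nc_poly_tsub: "p \<in> nc_poly \<Longrightarrow> q \<in> nc_poly \<Longrightarrow> tsub p q \<in> nc_poly"
  by (simp add: tsub_eq nc_poly.add nc_poly.scale)

lemma nc_poly_sum: "finite A \<Longrightarrow> (\<And>i. i \<in> A \<Longrightarrow> f i \<in> nc_poly) \<Longrightarrow> (\<lambda>w. \<Sum>i\<in>A. f i w) \<in> nc_poly"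
proof (induction rule: finite_induct)
  case empty show ?case by (simp add: nc_poly.zero)
next
  case (insert a A)
  then have "tadd (f a) (\<lambda>w. \<Sum>i\<in>A. f i w) \<in> nc_poly" by (intro nc_poly.add) auto
  then show ?case using insert by (simp add: tadd_def)
qed

lemma iota_eq: "iota A = (\<lambda>w. \<Sum>k<8. tscale (mtr (mmul A (sl3_dual k))) (tX k) w)"
proof
  fix w
  show "iota A w = (\<Sum>k<8. tscale (mtr (mmul A (sl3_dual k))) (tX k) w)"
  proof (cases "\<exists>k. w = [k]")
    case True
    then obtain k where "w = [k]" ..
    then show ?thesis by (simp add: iota_def tscale_def tX_def if_distrib[of "times _"] cong: if_cong)
  next
    case False
    then show ?thesis by (auto simp: iota_def tscale_def tX_def split: list.split intro!: sum.neutral)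
  qed
qed

lemma nc_poly_iota: "iota A \<in> nc_poly"
  unfolding iota_eq by (intro nc_poly_sum nc_poly.scale nc_poly_tX) auto

lemma sl3_ideal_tmul_left: "p \<in> nc_poly \<Longrightarrow> q \<in> sl3_ideal \<Longrightarrow> tmul p q \<in> sl3_ideal"
  by (induction rule: nc_poly.induct)
    (auto simp: tmul_zero_left tmul_tone_left tmul_tadd_left tmul_tscale_left tmul_assoc intro: sl3_ideal.intros)

lemma sl3_ideal_tmul_right: "p \<in> nc_poly \<Longrightarrow> q \<in> sl3_ideal \<Longrightarrow> tmul q p \<in> sl3_ideal"
  by (induction arbitrary: q rule: nc_poly.induct)
    (auto simp: tmul_zero_right tmul_tone_right tmul_tadd_right tmul_tscale_right
      simp flip: tmul_assoc intro: sl3_ideal.intros)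

text \<open>This makes the ideal proper, hence \<open>0 \<noteq> 1\<close> in the quotient.\<close>

lemma sl3_ideal_constant_term: "p \<in> sl3_ideal \<Longrightarrow> p [] = 0"
  by (induction rule: sl3_ideal.induct) (auto simp: tmul_Nil tsub_def tadd_def tscale_def tX_def iota_def)

lemma U_eq_refl: "U_eq p p"
  using sl3_ideal.zero by (simp add: U_eq_def tsub_def)

lemma U_eq_sym: "U_eq p q \<Longrightarrow> U_eq q p"
  using sl3_ideal.scale[of "tsub p q" "-1"] by (simp add: U_eq_def tsub_def tscale_def)

lemma U_eq_trans: "U_eq p q \<Longrightarrow> U_eq q r \<Longrightarrow> U_eq p r"
  using sl3_ideal.add[of "tsub p q" "tsub q r"] by (simp add: U_eq_def tsub_def tadd_def)

lemma U_eq_tadd: "U_eq p p' \<Longrightarrow> U_eq q q' \<Longrightarrow> U_eq (tadd p q) (tadd p' q')"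
  using sl3_ideal.add[of "tsub p p'" "tsub q q'"] by (simp add: U_eq_def tsub_def tadd_def algebra_simps)

lemma U_eq_tscale: "U_eq p q \<Longrightarrow> U_eq (tscale c p) (tscale c q)"
  using sl3_ideal.scale[of "tsub p q" c] by (simp add: U_eq_def tsub_def tscale_def algebra_simps)

lemma U_eq_tsub: "U_eq p p' \<Longrightarrow> U_eq q q' \<Longrightarrow> U_eq (tsub p q) (tsub p' q')"
  by (simp add: tsub_eq U_eq_tadd U_eq_tscale)

text \<open>Passing through \<open>tmul p q'\<close>, the multipliers applied to ideal elements are
  \<open>p\<close> on the left and \<open>q'\<close> on the right.\<close>

lemma U_eq_tmul:
  assumes "U_eq p p'" "U_eq q q'" "p \<in> nc_poly" "q' \<in> nc_poly"
  shows "U_eq (tmul p q) (tmul p' q')"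
proof (rule U_eq_trans)
  show "U_eq (tmul p q) (tmul p q')"
    using sl3_ideal_tmul_left[of p "tsub q q'"] assms by (simp add: U_eq_def tmul_tsub_right)
  show "U_eq (tmul p q') (tmul p' q')"
    using sl3_ideal_tmul_right[of q' "tsub p p'"] assms by (simp add: U_eq_def tmul_tsub_left)
qed

section \<open>The quotient by the ideal\<close>

text \<open>A partial equivalence, reflexive exactly on \<open>nc_poly\<close>, where multiplication
  is compatible with the ideal.\<close>

definition U_rel :: "talg \<Rightarrow> talg \<Rightarrow> bool" where
  "U_rel p q \<longleftrightarrow> p \<in> nc_poly \<and> q \<in> nc_poly \<and> U_eq p q"

lemma U_rel_eqI: "p = q \<Longrightarrow> q \<in> nc_poly \<Longrightarrow> U_rel p q"
  by (simp add: U_rel_def U_eq_refl)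

lemmas nc_poly_closed =
  nc_poly.zero nc_poly.one nc_poly.add nc_poly.scale nc_poly_tsub nc_poly_tmul nc_poly_tX nc_poly_iota

quotient_type usl3 = talg / partial: U_rel
proof (rule part_equivpI)
  show "\<exists>x. U_rel x x" using nc_poly.zero U_eq_refl by (auto simp: U_rel_def)
  show "symp U_rel" by (auto simp: symp_def U_rel_def intro: U_eq_sym)
  show "transp U_rel" by (auto simp: transp_def U_rel_def intro: U_eq_trans)
qed

instantiation usl3 :: real_algebra_1
begin

lift_definition zero_usl3 :: usl3 is "\<lambda>_. 0"
  by (simp add: U_rel_def nc_poly.zero U_eq_refl)
lift_definition one_usl3 :: usl3 is tone
  by (simp add: U_rel_def nc_poly.one U_eq_refl)
lift_definition plus_usl3 :: "usl3 \<Rightarrow> usl3 \<Rightarrow> usl3" is tadd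
  by (simp add: U_rel_def nc_poly.add U_eq_tadd)
lift_definition minus_usl3 :: "usl3 \<Rightarrow> usl3 \<Rightarrow> usl3" is tsub
  by (simp add: U_rel_def nc_poly_tsub U_eq_tsub)
lift_definition uminus_usl3 :: "usl3 \<Rightarrow> usl3" is "tscale (-1)"
  by (simp add: U_rel_def nc_poly.scale U_eq_tscale)
lift_definition times_usl3 :: "usl3 \<Rightarrow> usl3 \<Rightarrow> usl3" is tmul
  by (simp add: U_rel_def nc_poly_tmul U_eq_tmul)
lift_definition scaleR_usl3 :: "real \<Rightarrow> usl3 \<Rightarrow> usl3" is "\<lambda>r. tscale (of_real r)"
  by (simp add: U_rel_def nc_poly.scale U_eq_tscale)

instance
proof
  fix a b c :: usl3 and r s :: real
  \<comment> \<open>Except for \<open>0 \<noteq> 1\<close>, each law already holds for coefficient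
    functions, so only membership in \<open>nc_poly\<close> remains.\<close>
  show "a + b + c = a + (b + c)"
    by transfer (rule U_rel_eqI, simp add: tadd_def tsub_def tscale_def fun_eq_iff algebra_simps, simp add: U_rel_def nc_poly_closed)
  show "a + b = b + a"
    by transfer (rule U_rel_eqI, simp add: tadd_def tsub_def tscale_def fun_eq_iff algebra_simps, simp add: U_rel_def nc_poly_closed)
  show "0 + a = a"
    by transfer (rule U_rel_eqI, simp add: tadd_def tsub_def tscale_def fun_eq_iff algebra_simps, simp add: U_rel_def nc_poly_closed)
  show "- a + a = 0"
    by transfer (rule U_rel_eqI, simp add: tadd_def tsub_def tscale_def fun_eq_iff algebra_simps, simp add: U_rel_def nc_poly_closed)
  show "a - b = a + - b"
    by transfer (rule U_rel_eqI, simp add: tadd_def tsub_def tscale_def fun_eq_iff algebra_simps, simp add: U_rel_def nc_poly_closed)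
  show "a * b * c = a * (b * c)"
    by transfer (rule U_rel_eqI, simp add: tmul_assoc, simp add: U_rel_def nc_poly_closed)
  show "1 * a = a"
    by transfer (rule U_rel_eqI, simp add: tmul_tone_left, simp add: U_rel_def nc_poly_closed)
  show "a * 1 = a"
    by transfer (rule U_rel_eqI, simp add: tmul_tone_right, simp add: U_rel_def nc_poly_closed)
  show "(a + b) * c = a * c + b * c"
    by transfer (rule U_rel_eqI, simp add: tmul_tadd_left, simp add: U_rel_def nc_poly_closed)
  show "a * (b + c) = a * b + a * c"
    by transfer (rule U_rel_eqI, simp add: tmul_tadd_right, simp add: U_rel_def nc_poly_closed)
  show "r *\<^sub>R (a + b) = r *\<^sub>R a + r *\<^sub>R b"
    by transfer (rule U_rel_eqI, simp add: tadd_def tsub_def tscale_def fun_eq_iff algebra_simps, simp add: U_rel_def nc_poly_closed)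
  show "(r + s) *\<^sub>R a = r *\<^sub>R a + s *\<^sub>R a"
    by transfer (rule U_rel_eqI, simp add: tadd_def tsub_def tscale_def fun_eq_iff algebra_simps, simp add: U_rel_def nc_poly_closed)
  show "r *\<^sub>R s *\<^sub>R a = (r * s) *\<^sub>R a"
    by transfer (rule U_rel_eqI, simp add: tadd_def tsub_def tscale_def fun_eq_iff algebra_simps, simp add: U_rel_def nc_poly_closed)
  show "1 *\<^sub>R a = a"
    by transfer (rule U_rel_eqI, simp add: tadd_def tsub_def tscale_def fun_eq_iff algebra_simps, simp add: U_rel_def nc_poly_closed)
  show "r *\<^sub>R a * b = r *\<^sub>R (a * b)"
    by transfer (rule U_rel_eqI, simp add: tmul_tscale_left, simp add: U_rel_def nc_poly_closed)
  show "a * r *\<^sub>R b = r *\<^sub>R (a * b)"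
    by transfer (rule U_rel_eqI, simp add: tmul_tscale_right, simp add: U_rel_def nc_poly_closed)
  show "(0::usl3) \<noteq> 1"
    by transfer (use sl3_ideal_constant_term in \<open>force simp: U_rel_def U_eq_def tsub_def tone_def\<close>)
qed

end

lemma abs_usl3_eq_iff:
  assumes "p \<in> nc_poly" "q \<in> nc_poly"
  shows "abs_usl3 p = abs_usl3 q \<longleftrightarrow> U_eq p q"
  using Quotient_rel_abs2[OF Quotient_usl3] Quotient_rel[OF Quotient_usl3, of p q] assms
  by (auto simp: U_rel_def U_eq_refl)

lemma U_rel_refl: "p \<in> nc_poly \<Longrightarrow> U_rel p p"
  by (rule U_rel_eqI[OF refl])

lemma abs_tadd: "p \<in> nc_poly \<Longrightarrow> q \<in> nc_poly \<Longrightarrow> abs_usl3 (tadd p q) = abs_usl3 p + abs_usl3 q"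
  by (simp add: plus_usl3.abs_eq U_rel_refl)

lemma abs_tsub: "p \<in> nc_poly \<Longrightarrow> q \<in> nc_poly \<Longrightarrow> abs_usl3 (tsub p q) = abs_usl3 p - abs_usl3 q"
  by (simp add: minus_usl3.abs_eq U_rel_refl)

lemma abs_tmul: "p \<in> nc_poly \<Longrightarrow> q \<in> nc_poly \<Longrightarrow> abs_usl3 (tmul p q) = abs_usl3 p * abs_usl3 q"
  by (simp add: times_usl3.abs_eq U_rel_refl)

text \<open>The class \<open>real_algebra_1\<close> carries real scalars; \<open>iota\<close> has
  complex coefficients and needs this second action.\<close>

lift_definition scaleC_usl3 :: "complex \<Rightarrow> usl3 \<Rightarrow> usl3" is tscale
  by (simp add: U_rel_def nc_poly.scale U_eq_tscale)

lemma abs_tscale: "p \<in> nc_poly \<Longrightarrow> abs_usl3 (tscale c p) = scaleC_usl3 c (abs_usl3 p)"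
  by (simp add: scaleC_usl3.abs_eq U_rel_refl)

lemma scaleC_of_real: "scaleC_usl3 (of_real r) x = r *\<^sub>R x"
  by transfer (simp add: U_rel_def nc_poly.scale U_eq_tscale)

lemma scaleC_simps:
  "scaleC_usl3 0 x = 0" "scaleC_usl3 1 x = x" "scaleC_usl3 (-1) x = - x"
  using scaleC_of_real[of 0 x] scaleC_of_real[of 1 x] scaleC_of_real[of "-1" x] by simp_all

lemma scaleC_numeral: "scaleC_usl3 (numeral k) x = numeral k * x"
  using scaleC_of_real[of "numeral k" x] by (simp add: scaleR_conv_of_real)

lemma scaleC_mult:
  "scaleC_usl3 c x * y = scaleC_usl3 c (x * y)" "x * scaleC_usl3 c y = scaleC_usl3 c (x * y)"
  by (transfer, rule U_rel_eqI, simp add: tmul_tscale_left tmul_tscale_right,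
      simp add: U_rel_def nc_poly_closed)+

lemma scaleC_diff: "scaleC_usl3 c (x - y) = scaleC_usl3 c x - scaleC_usl3 c y"
  by (transfer, rule U_rel_eqI, simp add: tsub_def tscale_def algebra_simps,
      simp add: U_rel_def nc_poly_closed)

lemma scaleC_add: "scaleC_usl3 c (x + y) = scaleC_usl3 c x + scaleC_usl3 c y"
  by (transfer, rule U_rel_eqI, simp add: tadd_def tscale_def algebra_simps,
      simp add: U_rel_def nc_poly_closed)

lemma scaleC_scaleC: "scaleC_usl3 c (scaleC_usl3 d x) = scaleC_usl3 (c * d) x"
  by (transfer, rule U_rel_eqI, simp add: tscale_def algebra_simps,
      simp add: U_rel_def nc_poly_closed)

lemma abs_sum:
  "finite A \<Longrightarrow> (\<And>i. i \<in> A \<Longrightarrow> f i \<in> nc_poly) \<Longrightarrow>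
    abs_usl3 (\<lambda>w. \<Sum>i\<in>A. f i w) = (\<Sum>i\<in>A. abs_usl3 (f i))"
proof (induction rule: finite_induct)
  case empty show ?case by (simp add: zero_usl3.abs_eq)
next
  case (insert a A)
  then have "abs_usl3 (tadd (f a) (\<lambda>w. \<Sum>i\<in>A. f i w)) = abs_usl3 (f a) + (\<Sum>i\<in>A. abs_usl3 (f i))"
    by (subst abs_tadd) (auto intro: nc_poly_sum)
  then show ?case using insert by (simp add: tadd_def)
qed

lemma abs_tpow: "p \<in> nc_poly \<Longrightarrow> tpow p n \<in> nc_poly \<and> abs_usl3 (tpow p n) = abs_usl3 p ^ n"
  by (induction n) (auto simp: tpow_def nc_poly_closed abs_tmul one_usl3.abs_eq)

section \<open>Matrix units in the enveloping algebra\<close>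

definition \<iota>\<^sub>U :: "mat3 \<Rightarrow> usl3" where
  "\<iota>\<^sub>U A = abs_usl3 (iota A)"

text \<open>The map \<open>iota\<close> kills the identity matrix, because the dual basis is traceless; thus
  \<open>\<iota>\<^sub>U (mE p q)\<close> is the class of the traceless part of the matrix unit.\<close>

definition eq_mod_id :: "mat3 \<Rightarrow> mat3 \<Rightarrow> bool" where
  "eq_mod_id A B \<longleftrightarrow> (\<exists>t. \<forall>i<3. \<forall>j<3. A i j = B i j + (if i = j then t else 0))"

lemma lessThan_3: "{..<3} = {0, 1, 2::nat}" by auto
lemma lessThan_8: "{..<8} = {0, 1, 2, 3, 4, 5, 6, 7::nat}" by auto

lemma all_less_3: "(\<forall>i<3. P i) \<longleftrightarrow> P 0 \<and> P 1 \<and> P (2::nat)"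
  by (metis lessThan_3 lessThan_iff insert_iff empty_iff)

lemma sum_3: "(\<Sum>i<3. f i) = f 0 + f 1 + f (2::nat)"
  by (simp add: lessThan_3 add.assoc)

lemma mtr_sl3_dual: "mtr (sl3_dual k) = 0"
  by (simp add: mtr_def sl3_dual_def sl3_basis_def mlin_def mE_def sum_3)

lemma iota_cong:
  assumes "eq_mod_id A B" shows "\<iota>\<^sub>U A = \<iota>\<^sub>U B"
proof -
  obtain t where t: "\<And>i j. i < 3 \<Longrightarrow> j < 3 \<Longrightarrow> A i j = B i j + (if i = j then t else 0)"
    using assms by (auto simp: eq_mod_id_def)
  have "mtr (mmul A (sl3_dual k)) = mtr (mmul B (sl3_dual k)) + t * mtr (sl3_dual k)" for k
    by (simp add: mtr_def mmul_def t distrib_right sum.distrib sum_distrib_left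
        if_distrib[of "\<lambda>x. x * _"] cong: if_cong)
  then show ?thesis by (simp add: \<iota>\<^sub>U_def iota_eq mtr_sl3_dual)
qed

lemma iota_mlin: "\<iota>\<^sub>U (mlin r A s B) = scaleC_usl3 r (\<iota>\<^sub>U A) + scaleC_usl3 s (\<iota>\<^sub>U B)"
proof -
  have "mtr (mmul (mlin r A s B) C) = r * mtr (mmul A C) + s * mtr (mmul B C)" for C
    by (simp add: mtr_def mmul_def mlin_def algebra_simps sum.distrib sum_distrib_left)
  then have "iota (mlin r A s B) = tadd (tscale r (iota A)) (tscale s (iota B))"
    by (simp add: fun_eq_iff iota_def tadd_def tscale_def split: list.split)
  then show ?thesis
    by (simp add: \<iota>\<^sub>U_def abs_tadd abs_tscale nc_poly_closed)
qed

lemma iota_basis: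
  assumes "k < 8" shows "iota (sl3_basis k) = tX k"
proof -
  have "mtr (mmul (sl3_basis k) (sl3_dual l)) = (if k = l then 1 else 0)" if "l < 8" for l
    using assms that
    by (simp add: numeral_eq_Suc less_Suc_eq)
      (elim disjE; simp add: mtr_def mmul_def sum_3 sl3_dual_def sl3_basis_def mlin_def mE_def)
  then show ?thesis
    using assms by (auto simp: fun_eq_iff iota_def tX_def split: list.split)
qed

lemma mbr_mlin_left: "mbr (mlin r A s B) C = mlin r (mbr A C) s (mbr B C)"
  by (simp add: fun_eq_iff mbr_def mlin_def mmul_def algebra_simps sum.distrib sum_distrib_left)

lemma mbr_mlin_right: "mbr C (mlin r A s B) = mlin r (mbr C A) s (mbr C B)"
  by (simp add: fun_eq_iff mbr_def mlin_def mmul_def algebra_simps sum.distrib sum_distrib_left)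

text \<open>Scalar matrices commute with everything, so the two brackets even agree exactly on
  indices below 3.\<close>

lemma mbr_cong:
  assumes "eq_mod_id A A'" "eq_mod_id B B'" shows "eq_mod_id (mbr A B) (mbr A' B')"
proof -
  obtain t where t: "\<And>i j. i < 3 \<Longrightarrow> j < 3 \<Longrightarrow> A i j = A' i j + (if i = j then t else 0)"
    using assms by (auto simp: eq_mod_id_def)
  obtain s where s: "\<And>i j. i < 3 \<Longrightarrow> j < 3 \<Longrightarrow> B i j = B' i j + (if i = j then s else 0)"
    using assms by (auto simp: eq_mod_id_def)
  have "\<forall>i<3. \<forall>j<3. mbr A B i j = mbr A' B' i j"
    by (simp add: all_less_3 mbr_def mmul_def mlin_def sum_3 s t algebra_simps)
  then show ?thesis by (auto simp: eq_mod_id_def intro: exI[of _ 0])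
qed

lemma iota_bracket_basis:
  assumes "i < 8" "j < 8"
  shows "\<iota>\<^sub>U (sl3_basis i) * \<iota>\<^sub>U (sl3_basis j) - \<iota>\<^sub>U (sl3_basis j) * \<iota>\<^sub>U (sl3_basis i)
    = \<iota>\<^sub>U (mbr (sl3_basis i) (sl3_basis j))"
proof -
  have "U_eq (tsub (tmul (tX i) (tX j)) (tmul (tX j) (tX i))) (iota (mbr (sl3_basis i) (sl3_basis j)))"
    using sl3_ideal.rel[OF assms] by (simp add: U_eq_def)
  then have "abs_usl3 (tsub (tmul (tX i) (tX j)) (tmul (tX j) (tX i)))
      = abs_usl3 (iota (mbr (sl3_basis i) (sl3_basis j)))"
    using assms by (subst abs_usl3_eq_iff) (auto intro!: nc_poly_closed)
  then show ?thesis
    using assms by (simp add: \<iota>\<^sub>U_def iota_basis abs_tsub abs_tmul nc_poly_closed)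
qed

text \<open>Lets the bracket relation pass by bilinearity from the basis to all matrix
  units.\<close>

lemma mE_in_span_mod_id:
  assumes "a < 3" "b < 3"
  shows "\<exists>r i s j. i < 8 \<and> j < 8 \<and> eq_mod_id (mE a b) (mlin r (sl3_basis i) s (sl3_basis j))"
proof (cases "a = b")
  case True
  \<comment> \<open>The coefficients expand the traceless parts in the Cartan basis; the witness 1/3
    is the scalar removed.\<close>
  have "eq_mod_id (mE 0 0) (mlin (2/3) (sl3_basis 6) (1/3) (sl3_basis 7))"
    "eq_mod_id (mE 1 1) (mlin (-1/3) (sl3_basis 6) (1/3) (sl3_basis 7))"
    "eq_mod_id (mE 2 2) (mlin (-1/3) (sl3_basis 6) (-2/3) (sl3_basis 7))"
    unfolding eq_mod_id_def
    by (rule exI[of _ "1/3"], simp add: all_less_3 mE_def mlin_def sl3_basis_def)+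
  moreover have "a = 0 \<or> a = 1 \<or> a = 2" using assms by auto
  moreover have "6 < (8::nat)" "7 < (8::nat)" by simp_all
  ultimately show ?thesis
    using True by blast
next
  case False
  define k where "k = (if a = 0 then if b = 1 then 0 else 1 else if a = 1 then if b = 0 then 2 else 3
    else if b = 0 then 4 else (5::nat))"
  have "k < 8" by (simp add: k_def)
  moreover have "mE a b = mlin 1 (sl3_basis k) 0 (sl3_basis k)"
    using assms False by (auto simp: k_def sl3_basis_def mlin_def numeral_3_eq_3 less_Suc_eq numeral_2_eq_2)
  moreover have "eq_mod_id A A" for A
    by (auto simp: eq_mod_id_def intro: exI[of _ 0])
  ultimately show ?thesis by metis
qed

lemma iota_bracket_mE:
  assumes "a < 3" "b < 3" "c < 3" "d < 3"
  shows "\<iota>\<^sub>U (mE a b) * \<iota>\<^sub>U (mE c d) - \<iota>\<^sub>U (mE c d) * \<iota>\<^sub>U (mE a b) = \<iota>\<^sub>U (mbr (mE a b) (mE c d))"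
proof -
  obtain r i s j where 1: "i < 8" "j < 8" "eq_mod_id (mE a b) (mlin r (sl3_basis i) s (sl3_basis j))"
    using mE_in_span_mod_id[OF assms(1,2)] by blast
  obtain r' i' s' j' where 2: "i' < 8" "j' < 8" "eq_mod_id (mE c d) (mlin r' (sl3_basis i') s' (sl3_basis j'))"
    using mE_in_span_mod_id[OF assms(3,4)] by blast
  show ?thesis
    unfolding iota_cong[OF 1(3)] iota_cong[OF 2(3)] iota_cong[OF mbr_cong[OF 1(3) 2(3)]]
      mbr_mlin_left mbr_mlin_right iota_mlin iota_bracket_basis[OF 1(1) 2(1), symmetric]
      iota_bracket_basis[OF 1(1) 2(2), symmetric] iota_bracket_basis[OF 1(2) 2(1), symmetric]
      iota_bracket_basis[OF 1(2) 2(2), symmetric]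
    by (simp add: algebra_simps scaleC_mult scaleC_diff scaleC_add scaleC_scaleC)
qed

interpretation U: sl3_matrix "\<lambda>a b. \<iota>\<^sub>U (mE a b)"
proof
  fix a b c d :: nat assume *: "a < 3" "b < 3" "c < 3" "d < 3"
  have "mbr (mE a b) (mE c d) = mlin (if b = c then 1 else 0) (mE a d) (if a = d then -1 else 0) (mE c b)"
    using * by (auto simp: fun_eq_iff mbr_def mlin_def mmul_def mE_def if_distrib[of "\<lambda>x. x * _"] cong: if_cong)
  then show "\<iota>\<^sub>U (mE a b) * \<iota>\<^sub>U (mE c d) = \<iota>\<^sub>U (mE c d) * \<iota>\<^sub>U (mE a b)
      + (if b = c then \<iota>\<^sub>U (mE a d) else 0) - (if a = d then \<iota>\<^sub>U (mE c b) else 0)"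
    using iota_bracket_mE[OF *] by (auto simp: iota_mlin scaleC_simps algebra_simps)
next
  \<comment> \<open>The sum of the diagonal units is the identity. Zero is written as an
    \<open>mlin\<close> so that \<open>iota_mlin\<close> evaluates it.\<close>
  have "eq_mod_id (mlin 1 (mlin 1 (mE 0 0) 1 (mE 1 1)) 1 (mE 2 2)) (mlin 0 (mE 0 0) 0 (mE 0 0))"
    unfolding eq_mod_id_def by (rule exI[of _ 1]) (simp add: all_less_3 mE_def mlin_def)
  from iota_cong[OF this] show "(\<Sum>p<3. \<iota>\<^sub>U (mE p p)) = 0"
    by (simp add: iota_mlin scaleC_simps sum_3)
qed

section \<open>Weights of the diagrams\<close>

text \<open>Both sides apply \<open>f\<close> to the Casimir tensor. Off the diagonal the terms
  match one by one; on the Cartan part only coefficients 1 and -1 occur modulo the identity, so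
  biadditivity suffices.\<close>

lemma sum_basis_dual:
  fixes f :: "usl3 \<Rightarrow> usl3 \<Rightarrow> 'b::ab_group_add"
  assumes "\<And>y. additive (\<lambda>x. f x y)" "\<And>x. additive (f x)"
  shows "(\<Sum>i<8. f (abs_usl3 (tX i)) (\<iota>\<^sub>U (sl3_dual i))) = (\<Sum>p<3. \<Sum>q<3. f (\<iota>\<^sub>U (mE p q)) (\<iota>\<^sub>U (mE q p)))"
proof -
  have X: "abs_usl3 (tX i) = \<iota>\<^sub>U (sl3_basis i)" if "i < 8" for i
    using that by (simp add: \<iota>\<^sub>U_def iota_basis)
  have X6: "\<iota>\<^sub>U (sl3_basis 6) = \<iota>\<^sub>U (mE 0 0) - \<iota>\<^sub>U (mE 1 1)"
    and X7: "\<iota>\<^sub>U (sl3_basis 7) = \<iota>\<^sub>U (mE 1 1) - \<iota>\<^sub>U (mE 2 2)"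
    by (simp_all add: sl3_basis_def iota_mlin scaleC_simps)
  have "eq_mod_id (sl3_dual 6) (mE 0 0)"
    unfolding eq_mod_id_def
    by (rule exI[of _ "-1/3"]) (simp add: all_less_3 mE_def mlin_def sl3_basis_def sl3_dual_def)
  note D6 = iota_cong[OF this]
  have "eq_mod_id (sl3_dual 7) (mlin (-1) (mE 2 2) 0 (mE 0 0))"
    unfolding eq_mod_id_def
    by (rule exI[of _ "1/3"]) (simp add: all_less_3 mE_def mlin_def sl3_basis_def sl3_dual_def)
  then have D7: "\<iota>\<^sub>U (sl3_dual 7) = - \<iota>\<^sub>U (mE 2 2)"
    by (simp add: iota_cong iota_mlin scaleC_simps)
  have f: "f (x - x') y = f x y - f x' y" "f x (- y) = - f x y" "f x (y + y') = f x y + f x y'" for x x' y y'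
    using additive.diff[OF assms(1)] additive.minus[OF assms(2)] additive.add[OF assms(2)] by auto
  \<comment> \<open>The trace relation turns the two mixed terms into the missing diagonal term for
    \<open>mE 1 1\<close>.\<close>
  have "\<iota>\<^sub>U (mE 1 1) = - (\<iota>\<^sub>U (mE 0 0) + \<iota>\<^sub>U (mE 2 2))"
    using U.trace_zero by (simp add: sum_3 add_eq_0_iff2 algebra_simps)
  then have "f (\<iota>\<^sub>U (mE 1 1)) (\<iota>\<^sub>U (mE 1 1)) = - (f (\<iota>\<^sub>U (mE 1 1)) (\<iota>\<^sub>U (mE 0 0)) + f (\<iota>\<^sub>U (mE 1 1)) (\<iota>\<^sub>U (mE 2 2)))"
    by (metis f(2,3))
  then have "f (\<iota>\<^sub>U (sl3_basis 6)) (\<iota>\<^sub>U (sl3_dual 6)) + f (\<iota>\<^sub>U (sl3_basis 7)) (\<iota>\<^sub>U (sl3_dual 7))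
     = f (\<iota>\<^sub>U (mE 0 0)) (\<iota>\<^sub>U (mE 0 0)) + f (\<iota>\<^sub>U (mE 1 1)) (\<iota>\<^sub>U (mE 1 1)) + f (\<iota>\<^sub>U (mE 2 2)) (\<iota>\<^sub>U (mE 2 2))"
    unfolding X6 X7 D6 D7 f by (simp add: algebra_simps)
  then have "(\<Sum>i<8. f (\<iota>\<^sub>U (sl3_basis i)) (\<iota>\<^sub>U (sl3_dual i))) = (\<Sum>p<3. \<Sum>q<3. f (\<iota>\<^sub>U (mE p q)) (\<iota>\<^sub>U (mE q p)))"
    by (simp add: lessThan_8 sum_3 algebra_simps) (simp add: sl3_basis_def sl3_dual_def algebra_simps)
  then show ?thesis by (simp add: X)
qed

text \<open>The set \<open>S\<close> collects the chords whose first endpoint has already been passed.\<close>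

primrec endpoint_labels :: "(bool \<Rightarrow> nat \<Rightarrow> 'b) \<Rightarrow> nat set \<Rightarrow> nat list \<Rightarrow> 'b list" where
  "endpoint_labels g S [] = []"
| "endpoint_labels g S (a # w) = g (a \<in> S) a # endpoint_labels g (insert a S) w"

text \<open>Replaces the positional test in \<open>sl3_weight\<close> by a recursion along the word;
  the general \<open>S\<close> carries the induction.\<close>

lemma map_upt_eq_endpoint_labels:
  "map (\<lambda>k. g (w ! k \<in> S \<union> set (take k w)) (w ! k)) [0..<length w] = endpoint_labels g S w"
proof (induction w arbitrary: S)
  case (Cons a w)
  have "[0..<length (a # w)] = 0 # map Suc [0..<length w]"
    by (simp add: upt_conv_Cons map_Suc_upt del: upt_Suc)
  then show ?case using Cons.IH[of "insert a S"] by (simp add: comp_def disj_left_commute)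
qed simp

lemma endpoint_labels_append: "endpoint_labels g S (u @ v) = endpoint_labels g S u @ endpoint_labels g (S \<union> set u) v"
  by (induction u arbitrary: S) simp_all

lemma endpoint_labels_new: "distinct u \<Longrightarrow> set u \<inter> S = {} \<Longrightarrow> endpoint_labels g S u = map (g False) u"
  by (induction u arbitrary: S) auto

lemma endpoint_labels_old: "set u \<subseteq> S \<Longrightarrow> endpoint_labels g S u = map (g True) u"
  by (induction u arbitrary: S) (auto simp: subset_insertI2)

section \<open>Summing over labellings one chord at a time\<close>

definition assignments :: "nat set \<Rightarrow> (nat \<Rightarrow> nat) set" where
  "assignments A = {f. (\<forall>a. f a < 8) \<and> (\<forall>a. a \<notin> A \<longrightarrow> f a = 0)}"

lemma finite_assignments: "finite A \<Longrightarrow> finite (assignments A)"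
  by (rule finite_subset[OF _ finite_set_of_finite_funs[of A "{..<8}" 0]]) (auto simp: assignments_def)

lemma assignments_empty: "assignments {} = {\<lambda>_. 0}"
  by (auto simp: assignments_def)

lemma sum_assignments_insert:
  assumes "a \<notin> A"
  shows "(\<Sum>f\<in>assignments (insert a A). h f) = (\<Sum>i<8. \<Sum>f\<in>assignments A. h (f(a := i)))"
  unfolding sum.cartesian_product
  \<comment> \<open>Resetting \<open>f\<close> at \<open>a\<close> to the default value 0 yields an
    element of \<open>assignments A\<close>.\<close>
  by (rule sum.reindex_bij_witness[of _ "\<lambda>(i, f). f(a := i)" "\<lambda>f. (f a, f(a := 0))"])
    (use assms in \<open>auto simp: assignments_def fun_eq_iff\<close>)

lemma abs_foldr_tmul:
  "\<forall>p\<in>set ps. p \<in> nc_poly \<Longrightarrow>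
    foldr tmul ps tone \<in> nc_poly \<and> abs_usl3 (foldr tmul ps tone) = prod_list (map abs_usl3 ps)"
  by (induction ps) (simp_all add: nc_poly_closed abs_tmul one_usl3.abs_eq)

abbreviation XU :: "nat \<Rightarrow> usl3" where "XU i \<equiv> abs_usl3 (tX i)"
abbreviation DU :: "nat \<Rightarrow> usl3" where "DU i \<equiv> \<iota>\<^sub>U (sl3_dual i)"

lemma Phi_eq_sum_basis: "(\<Sum>i<8. XU i * z * DU i) = U.Phi z"
  unfolding U.Phi_def by (rule sum_basis_dual) (unfold_locales, simp_all add: algebra_simps)

lemma map_comp_fun_upd: "m \<notin> set xs \<Longrightarrow> map (\<lambda>k. h ((f(m := i)) k)) xs = map (\<lambda>k. h (f k)) xs"
  by auto

text \<open>The chords are nested around \<open>z\<close>. The chord added in the induction is the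
  innermost one, so it replaces \<open>z\<close> by \<open>Phi z\<close> before the hypothesis is
  applied.\<close>

lemma sum_assignments_nested:
  "(\<Sum>f\<in>assignments {2..<n+2}. prod_list (map (\<lambda>k. XU (f k)) [2..<n+2]) * z *
      prod_list (map (\<lambda>k. DU (f k)) (rev [2..<n+2]))) = (U.Phi ^^ n) z"
proof (induction n arbitrary: z)
  case 0 show ?case by (simp add: assignments_empty)
next
  case (Suc n)
  let ?P = "\<lambda>f. prod_list (map (\<lambda>k. XU (f k)) [2..<n+2])"
  let ?R = "\<lambda>f. prod_list (map (\<lambda>k. DU (f k)) (rev [2..<n+2]))"
  have *: "?P (f(n+2 := i)) = ?P f" "?R (f(n+2 := i)) = ?R f" for f i
    by (subst map_comp_fun_upd; simp del: upt_Suc)+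
  have notin: "n+2 \<notin> {2..<n+2}" by simp
  have "{2..<Suc n + 2} = insert (n+2) {2..<n+2}" "[2..<Suc n + 2] = [2..<n+2] @ [n+2]" by auto
  then have "(\<Sum>f\<in>assignments {2..<Suc n+2}. prod_list (map (\<lambda>k. XU (f k)) [2..<Suc n+2]) * z *
      prod_list (map (\<lambda>k. DU (f k)) (rev [2..<Suc n+2])))
    = (\<Sum>i<8. \<Sum>f\<in>assignments {2..<n+2}. ?P f * (XU i * z * DU i) * ?R f)"
    by (simp only: sum_assignments_insert[OF notin] map_append rev_append
      prod_list.append * list.map rev.simps append.simps prod_list.Cons prod_list.Nil mult_1_right fun_upd_same mult.assoc)
  also have "\<dots> = (\<Sum>f\<in>assignments {2..<n+2}. ?P f * U.Phi z * ?R f)"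
    by (subst sum.swap) (simp add: sum_distrib_left sum_distrib_right flip: Phi_eq_sum_basis)
  also have "\<dots> = (U.Phi ^^ Suc n) z"
    using Suc.IH by (simp add: funpow_swap1)
  finally show ?case .
qed

lemma abs_casimir2: "casimir2 \<in> nc_poly" "abs_usl3 casimir2 = U.cas"
proof -
  show "casimir2 \<in> nc_poly"
    unfolding casimir2_def by (intro nc_poly_sum) (auto intro: nc_poly_closed)
  have "abs_usl3 casimir2 = (\<Sum>i<8. XU i * 1 * DU i)"
    unfolding casimir2_def by (subst abs_sum) (auto simp: abs_tmul nc_poly_closed \<iota>\<^sub>U_def)
  then show "abs_usl3 casimir2 = U.cas"
    by (simp only: Phi_eq_sum_basis U.Phi_one)
qed

text \<open>The chords \<open>a_k b_k\<close> are nested around the adjacent points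
  \<open>p_2\<close> and \<open>p_3\<close>, so summing their labels gives \<open>Phi ^^ n\<close>;
  chords 0 and 1 remain as \<open>i\<close> and \<open>j\<close>.\<close>

lemma abs_sl3_weight_J0:
  "sl3_weight (J0 n) \<in> nc_poly"
  "abs_usl3 (sl3_weight (J0 n)) = (\<Sum>i<8. \<Sum>j<8. XU i * (U.Phi ^^ n) (DU i * XU j) * DU j)"
proof -
  define g where "g f b a = (if b then iota (sl3_dual (f a)) else tX (f a))" for f :: "nat \<Rightarrow> nat" and b a
  have setJ: "set (J0 n) = insert 0 (insert 1 {2..<n+2})"
    by (auto simp: J0_def)
  have w: "sl3_weight (J0 n) = (\<lambda>u. \<Sum>f\<in>assignments (set (J0 n)). foldr tmul (endpoint_labels (g f) {} (J0 n)) tone u)"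
    unfolding sl3_weight_def label_assignments_def assignments_def map_upt_eq_endpoint_labels[symmetric] g_def
    by simp
  have endpoint_labels: "endpoint_labels (g f) {} (J0 n) = [tX (f 0)] @ map (\<lambda>k. tX (f k)) [2..<n+2] @ [iota (sl3_dual (f 0)), tX (f 1)]
      @ map (\<lambda>k. iota (sl3_dual (f k))) (rev [2..<n+2]) @ [iota (sl3_dual (f 1))]" for f
  proof -
    have 1: "endpoint_labels (g f) {0} [2..<n+2] = map (g f False) [2..<n+2]"
      by (rule endpoint_labels_new) auto
    have 2: "endpoint_labels (g f) (insert 1 (insert 0 (insert 0 {2..<n+2}))) (rev [2..<n+2]) = map (g f True) (rev [2..<n+2])"
      by (rule endpoint_labels_old) auto
    show ?thesis
      using 1 2 unfolding J0_def
      by (simp add: endpoint_labels_append g_def insert_commute del: upt_Suc)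
  qed
  have nc: "\<forall>p\<in>set (endpoint_labels (g f) {} (J0 n)). p \<in> nc_poly" if "f \<in> assignments (set (J0 n))" for f
    using that unfolding endpoint_labels by (auto simp: assignments_def nc_poly_closed)
  have fin: "finite (assignments (set (J0 n)))" by (simp add: finite_assignments)
  show "sl3_weight (J0 n) \<in> nc_poly"
    unfolding w using nc fin by (intro nc_poly_sum) (auto dest: abs_foldr_tmul)
  let ?P = "\<lambda>f. prod_list (map (\<lambda>k. XU (f k)) [2..<n+2])"
  let ?R = "\<lambda>f. prod_list (map (\<lambda>k. DU (f k)) (rev [2..<n+2]))"
  have "abs_usl3 (sl3_weight (J0 n)) = (\<Sum>f\<in>assignments (set (J0 n)). prod_list (map abs_usl3 (endpoint_labels (g f) {} (J0 n))))"
    unfolding w using nc fin abs_foldr_tmul by (subst abs_sum) (auto intro!: sum.cong)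
  also have "\<dots> = (\<Sum>f\<in>assignments (insert 0 (insert 1 {2..<n+2})).
      XU (f 0) * (?P f * (DU (f 0) * XU (f 1)) * ?R f) * DU (f 1))"
    unfolding endpoint_labels setJ by (simp add: comp_def mult.assoc \<iota>\<^sub>U_def del: upt_Suc)
  also have "\<dots> = (\<Sum>i<8. \<Sum>j<8. \<Sum>f\<in>assignments {2..<n+2}. XU i * (?P f * (DU i * XU j) * ?R f) * DU j)"
  proof -
    have *: "?P (f(0 := i)) = ?P f" "?R (f(0 := i)) = ?R f" "?P (f(1 := i)) = ?P f" "?R (f(1 := i)) = ?R f" for f i
      by (subst map_comp_fun_upd; simp del: upt_Suc)+
    have notin: "0 \<notin> insert 1 {2..<n+2}" "1 \<notin> {2..<n+2}" by simp_all
    have "(f(1 := j, 0 := i)) 0 = i" "(f(1 := j, 0 := i)) 1 = j" for f :: "nat \<Rightarrow> nat" and i j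
      by simp_all
    then show ?thesis
      by (simp only: sum_assignments_insert[OF notin(1)] sum_assignments_insert[OF notin(2)] *)
  qed
  also have "\<dots> = (\<Sum>i<8. \<Sum>j<8. XU i * (U.Phi ^^ n) (DU i * XU j) * DU j)"
    by (simp only: sum_distrib_left[symmetric] sum_distrib_right[symmetric] sum_assignments_nested)
  finally show "abs_usl3 (sl3_weight (J0 n)) = (\<Sum>i<8. \<Sum>j<8. XU i * (U.Phi ^^ n) (DU i * XU j) * DU j)" .
qed

text \<open>\<open>sum_basis_dual\<close> is applied to one outer chord after the other; linearity
  of \<open>Phi ^^ n\<close> supplies the additivity.\<close>

lemma sum_basis_eq_contr:
  "(\<Sum>i<8. \<Sum>j<8. XU i * (U.Phi ^^ n) (DU i * XU j) * DU j)
    = U.contr (\<lambda>a b c d. (U.Phi ^^ n) (\<iota>\<^sub>U (mE a b) * \<iota>\<^sub>U (mE c d)))"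
proof -
  have add: "(U.Phi ^^ n) (x + y) = (U.Phi ^^ n) x + (U.Phi ^^ n) y" for x y
    by (rule linear_add[OF U.linear_Phi_funpow])
  let ?E = "\<lambda>a b. \<iota>\<^sub>U (mE a b)"
  have "(\<Sum>i<8. \<Sum>j<8. XU i * (U.Phi ^^ n) (DU i * XU j) * DU j)
    = (\<Sum>b<3. \<Sum>a<3. \<Sum>j<8. ?E b a * (U.Phi ^^ n) (?E a b * XU j) * DU j)"
    by (rule sum_basis_dual) (unfold_locales, simp_all add: algebra_simps sum.distrib add)
  also have "\<dots> = (\<Sum>b<3. \<Sum>a<3. \<Sum>c<3. \<Sum>d<3. ?E b a * (U.Phi ^^ n) (?E a b * ?E c d) * ?E d c)"
    by (intro sum.cong refl sum_basis_dual) (unfold_locales, simp_all add: algebra_simps add)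
  also have "\<dots> = U.contr (\<lambda>a b c d. (U.Phi ^^ n) (?E a b * ?E c d))"
    unfolding U.contr_def by (rule sum.swap)
  finally show ?thesis .
qed

lemma abs_J0_rhs:
  "J0_rhs n \<in> nc_poly"
  "abs_usl3 (J0_rhs n) = (1/40) *\<^sub>R (U.cas * ((27 * U.cas - 72) * (U.cas - 8) ^ n
     + (8 * U.cas + 72) * (U.cas - 3) ^ n + 5 * U.cas ^ (n + 1)))"
proof -
  have const: "tconst c \<in> nc_poly" for c
    by (simp add: tconst_def nc_poly_closed)
  have abs_const: "abs_usl3 (tconst (numeral k)) = numeral k" for k
    by (simp add: tconst_def abs_tscale nc_poly_closed scaleC_numeral flip: one_usl3.abs_eq)
  note nc = nc_poly_closed const abs_casimir2(1) abs_tpow[THEN conjunct1]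
  show "J0_rhs n \<in> nc_poly"
    by (simp add: J0_rhs_def nc)
  have "scaleC_usl3 (1/40) x = (1/40) *\<^sub>R x" for x
    using scaleC_of_real[of "1/40" x] by simp
  then show "abs_usl3 (J0_rhs n) = (1/40) *\<^sub>R (U.cas * ((27 * U.cas - 72) * (U.cas - 8) ^ n
     + (8 * U.cas + 72) * (U.cas - 3) ^ n + 5 * U.cas ^ (n + 1)))"
    by (simp add: J0_rhs_def nc abs_tmul abs_tadd abs_tsub abs_tscale abs_const scaleC_numeral abs_casimir2(2)
        abs_tpow[THEN conjunct2] del: power_Suc)
qed

theorem mainTheorem6:
  fixes n :: nat
  shows "U_eq (sl3_weight (J0 n)) (J0_rhs n)"
  unfolding abs_usl3_eq_iff[OF abs_sl3_weight_J0(1) abs_J0_rhs(1), symmetric]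
    abs_sl3_weight_J0(2) abs_J0_rhs(2) sum_basis_eq_contr
  by (rule U.contr_funpow_Phi)

end
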